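(* Let $f\colon\{0,1\}^n\to\{0,1,\perp\}$ be a partial function and let $F(x,y)=f(x\oplus y)$. Suppose $\mathrm{D_{cc}^{\rightarrow}}(F)=t$ and $f$ is undefined (i.e. takes value $\perp$) on fewer than $\binom{n-t+1}{\lfloor\frac{n-t}{2}\rfloor-1}$ inputs. Then $\mathrm{NADT^{\oplus}}(f)=t$.
   Context: For a partial function $f\colon\{0,1\}^n\to\{0,1,\perp\}$ let $\operatorname{Dom}(f)=f^{-1}(\{0,1\})$. $\oplus$ denotes bitwise XOR, and $F(x,y)=f(x\oplus y)$ has domain $\operatorname{Dom}(F)=\{(x,y): x\oplus y\in\operatorname{Dom}(f)\}$. A one-way communication protocol of cost $t$ for $F$ consists of total functions $h\colon\{0,1\}^n\to\{0,1\}^t$ and $\varphi\colon\{0,1\}^t\times\{0,1\}^n\to\{0,1\}$ such that $\varphi(h(x),y)=F(x,y)$ for all $(x,y)\in\operatorname{Dom}(F)$; $\mathrm{D_{cc}^{\rightarrow}}(F)$ is the minimum such $t$. For $s,x\in\{0,1\}^n$ let $\langle s,x\rangle=\bigoplus_i s_i\wedge x_i$. A non-adaptive parity decision tree of cost $p$ for $f$ consists of vectors $s_1,\dots,s_p\in\{0,1\}^n$ and a total function $l\colon\{0,1\}^p\to\{0,1\}$ with $l(\langle s_1,x\rangle,\dots,\langle s_p,x\rangle)=f(x)$ for all $x\in\operatorname{Dom}(f)$; $\mathrm{NADT^{\oplus}}(f)$ is the minimum such $p$. *)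

theory Defs
  imports Main
begin

text \<open>
  The cube \<open>{0,1}\<^sup>n\<close> is the set of Boolean lists of length \<open>n\<close>; a partial
  Boolean function is a function into \<^typ>\<open>bool option\<close>, where \<^term>\<open>None\<close> stands for the
  undefined value. Only its values on \<open>cube n\<close> are ever referred to.
\<close>

definition cube :: "nat \<Rightarrow> bool list set" where
  "cube n = {x. length x = n}"

definition bxor :: "bool list \<Rightarrow> bool list \<Rightarrow> bool list"  (infixl "\<oplus>" 65) where
  "x \<oplus> y = map2 (\<noteq>) x y"

definition ip2 :: "bool list \<Rightarrow> bool list \<Rightarrow> bool" where
  "ip2 s x = foldr (\<noteq>) (map2 (\<and>) s x) False"

definition xor_fun :: "(bool list \<Rightarrow> bool option) \<Rightarrow> bool list \<Rightarrow> bool list \<Rightarrow> bool option" where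
  "xor_fun f x y = f (x \<oplus> y)"

definition one_way_protocol ::
  "nat \<Rightarrow> (bool list \<Rightarrow> bool list \<Rightarrow> bool option) \<Rightarrow> nat \<Rightarrow>
   (bool list \<Rightarrow> bool list) \<Rightarrow> (bool list \<Rightarrow> bool list \<Rightarrow> bool) \<Rightarrow> bool" where
  "one_way_protocol n F t h \<phi> \<longleftrightarrow>
     (\<forall>x \<in> cube n. h x \<in> cube t) \<and>
     (\<forall>x \<in> cube n. \<forall>y \<in> cube n. F x y \<noteq> None \<longrightarrow> F x y = Some (\<phi> (h x) y))"

definition Dcc_oneway :: "nat \<Rightarrow> (bool list \<Rightarrow> bool list \<Rightarrow> bool option) \<Rightarrow> nat" where
  "Dcc_oneway n F = (LEAST t. \<exists>h \<phi>. one_way_protocol n F t h \<phi>)"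

definition na_parity_tree ::
  "nat \<Rightarrow> (bool list \<Rightarrow> bool option) \<Rightarrow> nat \<Rightarrow> bool list list \<Rightarrow> (bool list \<Rightarrow> bool) \<Rightarrow> bool" where
  "na_parity_tree n f p ss l \<longleftrightarrow>
     length ss = p \<and> set ss \<subseteq> cube n \<and>
     (\<forall>x \<in> cube n. f x \<noteq> None \<longrightarrow> f x = Some (l (map (\<lambda>s. ip2 s x) ss)))"

definition NADT_parity :: "nat \<Rightarrow> (bool list \<Rightarrow> bool option) \<Rightarrow> nat" where
  "NADT_parity n f = (LEAST p. \<exists>ss l. na_parity_tree n f p ss l)"

text \<open>
  Binomial coefficient with integer arguments: it is 0 for a negative lower index. On
  natural numbers \<open>k div 2 - 1\<close> would be truncated to 0 for \<open>k < 2\<close>.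
\<close>

definition binom :: "int \<Rightarrow> int \<Rightarrow> nat" where
  "binom m k = (if 0 \<le> k \<and> k \<le> m then nat m choose nat k else 0)"

text \<open>Both minima range over nonempty sets.\<close>

lemma ex_one_way_protocol: "\<exists>h \<phi>. one_way_protocol n F n h \<phi>"
  unfolding one_way_protocol_def
  by (rule exI[of _ "\<lambda>x. x"], rule exI[of _ "\<lambda>a y. F a y = Some True"]) auto

lemma Dcc_oneway_attained: "\<exists>h \<phi>. one_way_protocol n F (Dcc_oneway n F) h \<phi>"
  unfolding Dcc_oneway_def by (rule LeastI, rule ex_one_way_protocol)

lemma Dcc_oneway_le: "Dcc_oneway n F \<le> n"
  unfolding Dcc_oneway_def by (rule Least_le, rule ex_one_way_protocol)

lemma ip2_Nil [simp]: "ip2 [] x = False" "ip2 s [] = False"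
  by (simp_all add: ip2_def)

lemma ip2_Cons [simp]: "ip2 (a # s) (b # x) \<longleftrightarrow> (a \<and> b) \<noteq> ip2 s x"
  by (simp add: ip2_def)

lemma ip2_zero [simp]: "ip2 (replicate n False) x = False"
proof (induction n arbitrary: x)
  case (Suc n)
  then show ?case by (cases x) auto
qed simp

lemma ip2_unit: "length x = n \<Longrightarrow> i < n \<Longrightarrow> ip2 ((replicate n False)[i := True]) x = x ! i"
proof (induction x arbitrary: n i)
  case (Cons b x)
  then show ?case by (cases n; cases i) auto
qed simp

lemma ex_na_parity_tree: "\<exists>ss l. na_parity_tree n f n ss l"
proof -
  define ss where "ss = map (\<lambda>i. (replicate n False)[i := True]) [0..<n]"
  have *: "map (\<lambda>s. ip2 s x) ss = x" if "x \<in> cube n" for x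
    using that by (intro nth_equalityI) (auto simp: ss_def cube_def ip2_unit)
  have "na_parity_tree n f n ss (\<lambda>a. f a = Some True)"
    unfolding na_parity_tree_def using * by (auto simp: ss_def cube_def)
  then show ?thesis by blast
qed

lemma NADT_parity_attained: "\<exists>ss l. na_parity_tree n f (NADT_parity n f) ss l"
  unfolding NADT_parity_def by (rule LeastI, rule ex_na_parity_tree)

end

theory Submission
  imports Defs
begin

text \<open>
  Some fibre of Alice's message function has at least \<open>2^(n - t)\<close> elements; let \<open>A\<close> be a
  translate of it containing 0 and \<open>V\<close> the span of \<open>A\<close>, so that \<open>V\<close> has codimension at most
  \<open>t\<close>. It suffices that the defined values of \<open>f\<close> agree on each coset of \<open>V\<close>. Otherwise the
  defined points of some coset split into nonempty classes \<open>S\<close> and \<open>T\<close>, and correctness of the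
  protocol makes \<open>S + A\<close> and \<open>T + A\<close> disjoint. By Olson's inequality
  \<open>|S + A| \<ge> |S| + |A| / 2\<close>, and likewise for \<open>T\<close>, so at least \<open>|A| \<ge> 2^(n - t)\<close> points of the
  coset are undefined, which is no less than the binomial coefficient.
\<close>

subsection \<open>The cube as a vector space over the two-element field\<close>

lemma bxor_Cons [simp]: "(a # x) \<oplus> (b # y) = (a \<noteq> b) # (x \<oplus> y)"
  by (simp add: bxor_def)

lemma bxor_Nil [simp]: "[] \<oplus> y = []" "x \<oplus> [] = []"
  by (simp_all add: bxor_def)

lemma length_bxor [simp]: "length (x \<oplus> y) = min (length x) (length y)"
  by (simp add: bxor_def)

lemma bxor_commute: "x \<oplus> y = y \<oplus> x"
proof (induction x arbitrary: y)
  case (Cons a x)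
  then show ?case by (cases y) auto
qed simp

lemma bxor_assoc: "(x \<oplus> y) \<oplus> z = x \<oplus> (y \<oplus> z)"
proof (induction x arbitrary: y z)
  case (Cons a x)
  then show ?case by (cases y; cases z) auto
qed simp

lemma bxor_left_commute: "x \<oplus> (y \<oplus> z) = y \<oplus> (x \<oplus> z)"
  by (metis bxor_assoc bxor_commute)

lemmas bxor_ac = bxor_assoc bxor_commute bxor_left_commute

lemma bxor_self: "x \<oplus> x = replicate (length x) False"
  by (induction x) auto

lemma bxor_zero: "x \<oplus> replicate (length x) False = x"
  by (induction x) auto

lemma bxor_cancel: "length x = length y \<Longrightarrow> x \<oplus> (x \<oplus> y) = y"
  by (simp add: bxor_assoc[symmetric] bxor_self) (metis bxor_commute bxor_zero)

lemma bxor_in_cube: "x \<in> cube n \<Longrightarrow> y \<in> cube n \<Longrightarrow> x \<oplus> y \<in> cube n"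
  by (simp add: cube_def)

lemma cube_cancel: "x \<in> cube n \<Longrightarrow> y \<in> cube n \<Longrightarrow> x \<oplus> (x \<oplus> y) = y"
  by (simp add: cube_def bxor_cancel)

lemma inj_on_bxor: "x \<in> cube n \<Longrightarrow> inj_on ((\<oplus>) x) (cube n)"
  by (rule inj_onI) (metis cube_cancel)

lemma card_translate:
  assumes "x \<in> cube n" "S \<subseteq> cube n"
  shows "card ((\<oplus>) x ` S) = card S"
  using assms inj_on_bxor inj_on_subset card_image by blast

lemma finite_cube [simp]: "finite (cube n)"
  using finite_lists_length_eq[of "UNIV :: bool set" n] by (simp add: cube_def)

lemma card_cube: "card (cube n) = 2 ^ n"
  using card_lists_length_eq[of "UNIV :: bool set" n] by (simp add: cube_def)

section \<open>Parities as linear forms, and subspaces cut out by them\<close>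

lemma ip2_bxor: "length x = length y \<Longrightarrow> ip2 s (x \<oplus> y) = (ip2 s x \<noteq> ip2 s y)"
proof (induction s arbitrary: x y)
  case (Cons a s)
  then show ?case by (cases x; cases y) auto
qed simp

text \<open>Over the two-element field the only scalars are 0 and 1, so closure under addition
  already gives a linear subspace.\<close>

definition bsubspace :: "nat \<Rightarrow> bool list set \<Rightarrow> bool" where
  "bsubspace n V \<longleftrightarrow> V \<subseteq> cube n \<and> replicate n False \<in> V \<and> (\<forall>x\<in>V. \<forall>y\<in>V. x \<oplus> y \<in> V)"

lemma bsubspace_cube: "bsubspace n (cube n)"
  by (auto simp: bsubspace_def cube_def)

lemma bsubspace_insert:
  assumes V: "bsubspace n V" and v: "v \<in> cube n"
  shows "bsubspace n (V \<union> (\<oplus>) v ` V)"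
proof -
  have Vn: "V \<subseteq> cube n" and zero: "replicate n False \<in> V"
    and closed: "\<And>x y. x \<in> V \<Longrightarrow> y \<in> V \<Longrightarrow> x \<oplus> y \<in> V"
    using V by (auto simp: bsubspace_def)
  have mixed: "x \<oplus> (v \<oplus> y) \<in> (\<oplus>) v ` V" "(v \<oplus> x) \<oplus> y \<in> (\<oplus>) v ` V"
    if "x \<in> V" "y \<in> V" for x y
    using closed[OF that] by (simp_all add: bxor_assoc bxor_left_commute[of x v])
  have "(v \<oplus> x) \<oplus> (v \<oplus> y) = v \<oplus> (v \<oplus> (x \<oplus> y))" for x y
    by (simp add: bxor_assoc bxor_left_commute[of x v])
  then have both: "(v \<oplus> x) \<oplus> (v \<oplus> y) \<in> V" if "x \<in> V" "y \<in> V" for x y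
    using closed[OF that] cube_cancel[OF v] Vn by (metis subsetD)
  have "x \<oplus> y \<in> V \<union> (\<oplus>) v ` V" if "x \<in> V \<union> (\<oplus>) v ` V" "y \<in> V \<union> (\<oplus>) v ` V" for x y
    using that by (elim UnE imageE) (simp_all add: closed mixed both)
  moreover have "V \<union> (\<oplus>) v ` V \<subseteq> cube n"
    using Vn bxor_in_cube[OF v] by blast
  ultimately show ?thesis
    using zero unfolding bsubspace_def by simp
qed

text \<open>Induction on the dimension by splitting off the first coordinate. A parity on the tails
  that vanishes on the slice \<open>V0\<close> is extended by a suitable coefficient at the
  head.\<close>

lemma separating_parity:
  assumes "bsubspace n V" "v \<in> cube n" "v \<notin> V"
  shows "\<exists>s\<in>cube n. ip2 s v \<and> (\<forall>x\<in>V. \<not> ip2 s x)"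
  using assms
proof (induction n arbitrary: V v)
  case 0
  then show ?case by (auto simp: bsubspace_def cube_def)
next
  case (Suc n)
  define V0 where "V0 = {x. False # x \<in> V}"
  have closed: "x \<oplus> y \<in> V" if "x \<in> V" "y \<in> V" for x y
    using that Suc.prems(1) by (auto simp: bsubspace_def)
  have len: "length x = Suc n" if "x \<in> V" for x
    using that Suc.prems(1) by (auto simp: bsubspace_def cube_def)
  have V0: "bsubspace n V0"
    unfolding bsubspace_def
  proof (intro conjI ballI subsetI)
    show "x \<in> cube n" if "x \<in> V0" for x
      using len that by (force simp: V0_def cube_def)
    show "replicate n False \<in> V0"
      using Suc.prems(1) by (auto simp: V0_def bsubspace_def)
    show "x \<oplus> y \<in> V0" if "x \<in> V0" "y \<in> V0" for x y
      using closed[of "False # x" "False # y"] that by (simp add: V0_def)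
  qed
  obtain b v' where v: "v = b # v'" "length v' = n"
    using Suc.prems(2) by (auto simp: cube_def length_Suc_conv)
  show ?case
  proof (cases "\<exists>w. True # w \<in> V")
    case True
    then obtain w where w: "True # w \<in> V" by blast
    have lw: "length w = n" using len[OF w] by simp
    \<comment> \<open>Adding \<open>True # w\<close> to \<open>v\<close>, if necessary, clears its
      head without changing its coset modulo \<open>V\<close>; \<open>u\<close> is the remaining
      tail.\<close>
    define u where "u = (if b then v' \<oplus> w else v')"
    have lu: "length u = n" using v lw by (simp add: u_def)
    have "u \<notin> V0"
    proof
      assume "u \<in> V0"
      then have "False # u \<in> V" by (simp add: V0_def)
      moreover from closed[OF w this] have "True # (w \<oplus> u) \<in> V" by simp
      moreover have "b \<Longrightarrow> w \<oplus> u = v'"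
        using bxor_cancel[of w v'] lw v by (simp add: u_def bxor_commute)
      ultimately show False
        using Suc.prems(3) v by (cases b) (auto simp: u_def)
    qed
    then obtain s where s: "s \<in> cube n" "ip2 s u" "\<forall>x\<in>V0. \<not> ip2 s x"
      using Suc.IH[OF V0] lu by (auto simp: cube_def)
    \<comment> \<open>The head coefficient \<open>ip2 s w\<close> is the one that makes the extended
      parity vanish at \<open>True # w\<close>.\<close>
    have "\<not> ip2 (ip2 s w # s) x" if x: "x \<in> V" for x
    proof -
      obtain c x' where x': "x = c # x'" "length x' = n"
        using len[OF x] by (auto simp: length_Suc_conv)
      show ?thesis
      proof (cases c)
        case True
        then have "x' \<oplus> w \<in> V0"
          using closed[OF x w] x' by (simp add: V0_def)
        then show ?thesis using s x' lw True by (auto simp: ip2_bxor)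
      next
        case False
        then show ?thesis using s x x' by (auto simp: V0_def)
      qed
    qed
    moreover have "ip2 (ip2 s w # s) v"
      using s(2) v lw by (auto simp: u_def ip2_bxor split: if_splits)
    ultimately show ?thesis
      using s(1) by (intro bexI[of _ "ip2 s w # s"]) (auto simp: cube_def)
  next
    case False
    have split: "\<exists>x'. x = False # x' \<and> x' \<in> V0" if "x \<in> V" for x
      using len[OF that] that False by (auto simp: length_Suc_conv V0_def) metis
    show ?thesis
    proof (cases b)
      case True
      \<comment> \<open>All of \<open>V\<close> has head False while \<open>v\<close> has head True,
        so the first coordinate itself separates.\<close>
      then show ?thesis
        using v by (intro bexI[of _ "True # replicate n False"]) (auto simp: cube_def dest!: split)
    next
      case b: False
      then have "v' \<notin> V0" using Suc.prems(3) v by (simp add: V0_def)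
      then obtain s where "s \<in> cube n" "ip2 s v'" "\<forall>x\<in>V0. \<not> ip2 s x"
        using Suc.IH[OF V0] v by (auto simp: cube_def)
      then show ?thesis
        using v b by (intro bexI[of _ "False # s"]) (auto simp: cube_def dest!: split)
    qed
  qed
qed

text \<open>The cardinality hypothesis says that \<open>V\<close> has codimension at most
  \<open>t\<close>, without mentioning bases. Adjoining an outside vector \<open>v\<close> doubles
  \<open>V\<close> and lowers the codimension by one; a parity vanishing on \<open>V\<close> but not
  at \<open>v\<close> then removes the added coset.\<close>

lemma parity_kernel_subset:
  assumes "bsubspace n V" "2 ^ n \<le> card V * 2 ^ t"
  shows "\<exists>ss. length ss = t \<and> set ss \<subseteq> cube n \<and> (\<forall>x\<in>cube n. (\<forall>s\<in>set ss. \<not> ip2 s x) \<longrightarrow> x \<in> V)"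
  using assms
proof (induction t arbitrary: V)
  case 0
  then have "V = cube n"
    by (intro card_seteq) (auto simp: bsubspace_def card_cube)
  then show ?case by simp
next
  case (Suc t)
  have Vn: "V \<subseteq> cube n" using Suc.prems(1) by (simp add: bsubspace_def)
  show ?case
  proof (cases "V = cube n")
    case True
    then show ?thesis
      \<comment> \<open>Zero parities pad the list to the prescribed length.\<close>
      by (intro exI[of _ "replicate (Suc t) (replicate n False)"]) (auto simp: cube_def)
  next
    case False
    then obtain v where v: "v \<in> cube n" "v \<notin> V" using Vn by blast
    let ?W = "V \<union> (\<oplus>) v ` V"
    have "V \<inter> (\<oplus>) v ` V = {}"
    proof (rule ccontr)
      assume "V \<inter> (\<oplus>) v ` V \<noteq> {}"
      then obtain x where x: "x \<in> V" "v \<oplus> x \<in> V" by blast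
      then have "x \<oplus> (v \<oplus> x) \<in> V" using Suc.prems(1) by (simp add: bsubspace_def)
      moreover have "x \<oplus> (v \<oplus> x) = v" using x v Vn cube_cancel bxor_commute by (metis subsetD)
      ultimately show False using v by simp
    qed
    moreover have "finite V" using Vn finite_cube finite_subset by blast
    ultimately have "card ?W = 2 * card V"
      using card_translate[OF v(1) Vn] by (simp add: card_Un_disjoint)
    then have "2 ^ n \<le> card ?W * 2 ^ t" using Suc.prems(2) by simp
    from Suc.IH[OF bsubspace_insert[OF Suc.prems(1) v(1)] this]
    obtain ss where ss: "length ss = t" "set ss \<subseteq> cube n"
      "\<And>x. x \<in> cube n \<Longrightarrow> \<forall>s\<in>set ss. \<not> ip2 s x \<Longrightarrow> x \<in> ?W" by blast
    obtain s where s: "s \<in> cube n" "ip2 s v" "\<forall>x\<in>V. \<not> ip2 s x"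
      using separating_parity[OF Suc.prems(1) v] by blast
    have "x \<in> V" if x: "x \<in> cube n" "\<forall>r\<in>set (s # ss). \<not> ip2 r x" for x
    proof (rule ccontr)
      assume "x \<notin> V"
      with ss(3)[of x] x obtain y where y: "y \<in> V" "x = v \<oplus> y" by auto
      then have "ip2 s x"
        using s v Vn by (auto simp: ip2_bxor cube_def subset_iff)
      with x show False by simp
    qed
    then show ?thesis
      using ss s by (intro exI[of _ "s # ss"]) auto
  qed
qed

subsection \<open>Olson's inequality\<close>

definition sumset :: "bool list set \<Rightarrow> bool list set \<Rightarrow> bool list set" where
  "sumset X Y = {x \<oplus> y | x y. x \<in> X \<and> y \<in> Y}"

lemma sumset_Un: "sumset (X \<union> Y) A = sumset X A \<union> sumset Y A"
  by (auto simp: sumset_def)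

lemma sumset_Int: "sumset (X \<inter> Y) A \<subseteq> sumset X A \<inter> sumset Y A"
  by (auto simp: sumset_def)

lemma sumset_translate: "sumset ((\<oplus>) c ` X) A = (\<oplus>) c ` sumset X A"
  by (auto simp: sumset_def bxor_assoc image_iff) (metis bxor_assoc)+

text \<open>Adding \<open>A\<close> commutes with unions and sends an intersection into the
  intersection of the sumsets, so inclusion-exclusion applies.\<close>

lemma card_sumset_submodular:
  assumes "finite (sumset X A)" "finite (sumset Y A)"
  shows "card (sumset (X \<union> Y) A) + card (sumset (X \<inter> Y) A)
    \<le> card (sumset X A) + card (sumset Y A)"
proof -
  have "card (sumset (X \<inter> Y) A) \<le> card (sumset X A \<inter> sumset Y A)"
    using assms sumset_Int by (intro card_mono) auto
  then show ?thesis
    using card_Un_Int[OF assms] by (simp add: sumset_Un)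
qed

text \<open>
  Hamidoune's isoperimetric method: a smallest set among those minimising \<open>|X + A| - |X|\<close> is,
  after translation, a subspace, because by submodularity two such sets meeting each other
  coincide.
\<close>

lemma olson_inequality:
  assumes V: "bsubspace n V" and A: "A \<subseteq> V" "replicate n False \<in> A"
    and gen: "\<And>W. bsubspace n W \<Longrightarrow> A \<subseteq> W \<Longrightarrow> V \<subseteq> W"
    and S: "S \<subseteq> V" "S \<noteq> {}" "sumset S A \<noteq> V"
  shows "2 * card S + card A \<le> 2 * card (sumset S A)"
proof -
  have Vn: "V \<subseteq> cube n"
    and closed: "\<And>x y. x \<in> V \<Longrightarrow> y \<in> V \<Longrightarrow> x \<oplus> y \<in> V"
    using V by (auto simp: bsubspace_def)
  have finV: "finite V" using Vn finite_cube finite_subset by blast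
  have cancel: "x \<oplus> (x \<oplus> y) = y" if "x \<in> V" "y \<in> V" for x y
    using that Vn cube_cancel by blast
  have zero: "x \<oplus> replicate n False = x" if "x \<in> V" for x
    using that Vn bxor_zero[of x] by (auto simp: cube_def)
  have subV: "sumset X A \<subseteq> V" if "X \<subseteq> V" for X
    using that A closed by (auto simp: sumset_def)
  have sup: "X \<subseteq> sumset X A" if "X \<subseteq> V" for X
    using that A zero by (force simp: sumset_def)
  have fin: "finite X" if "X \<subseteq> V" for X using that finV finite_subset by blast
  have cle: "card X \<le> card (sumset X A)" if "X \<subseteq> V" for X
    using that by (intro card_mono fin subV sup)
  \<comment> \<open>The condition that X + A is not all of \<open>V\<close> excludes
    \<open>V\<close> itself, whose growth is 0. The truncated subtraction in \<open>bd\<close> is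
    exact on subsets of \<open>V\<close> by \<open>cle\<close>.\<close>
  define adm where "adm X \<longleftrightarrow> X \<subseteq> V \<and> X \<noteq> {} \<and> sumset X A \<noteq> V" for X
  define bd where "bd X = card (sumset X A) - card X" for X
  obtain F where F: "adm F" "\<And>X. adm X \<Longrightarrow> bd F \<le> bd X"
    using ex_has_least_nat[of adm S bd] S by (auto simp: adm_def)
  define k where "k = bd F"
  have lower: "card X + k \<le> card (sumset X A)" if "adm X" for X
    using F(2)[OF that] cle[of X] that by (auto simp: k_def bd_def adm_def)
  define frag where "frag X \<longleftrightarrow> adm X \<and> card (sumset X A) = card X + k" for X
  have "frag F" using F(1) cle[of F] by (auto simp: frag_def k_def bd_def adm_def)
  then obtain M0 where M0: "frag M0" "\<And>X. frag X \<Longrightarrow> card M0 \<le> card X"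
    using ex_has_least_nat[of frag F card] by blast
  have transl: "frag ((\<oplus>) c ` X) \<and> card ((\<oplus>) c ` X) = card X" if "frag X" "c \<in> V" for c X
  proof -
    have X: "X \<subseteq> V" "X \<noteq> {}" "sumset X A \<noteq> V" using that by (auto simp: frag_def adm_def)
    have c: "c \<in> cube n" using that Vn by blast
    have 1: "card ((\<oplus>) c ` X) = card X"
      using card_translate[OF c] X Vn by blast
    have 2: "card (sumset ((\<oplus>) c ` X) A) = card (sumset X A)"
      using card_translate[OF c] subV[OF X(1)] Vn by (simp add: sumset_translate)
    have "card (sumset X A) < card V"
      using X(3) subV[OF X(1)] finV by (meson psubsetI psubset_card_mono)
    then have "sumset ((\<oplus>) c ` X) A \<noteq> V" using 2 by auto
    then show ?thesis
      using 1 2 X that closed by (auto simp: frag_def adm_def)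
  qed
  obtain c where c: "c \<in> M0" "c \<in> V" using M0(1) by (auto simp: frag_def adm_def)
  \<comment> \<open>Translating by a member \<open>c\<close> puts c + c = 0 into the set.\<close>
  define M where "M = (\<oplus>) c ` M0"
  have M: "frag M" "\<And>X. frag X \<Longrightarrow> card M \<le> card X"
    using transl[OF M0(1) c(2)] M0(2) by (auto simp: M_def)
  have MV: "M \<subseteq> V" "M \<noteq> {}" "sumset M A \<noteq> V" "card (sumset M A) = card M + k"
    using M(1) by (auto simp: frag_def adm_def)
  have "c \<oplus> c = replicate n False" using c(2) Vn bxor_self[of c] by (auto simp: cube_def)
  then have M0in: "replicate n False \<in> M" using c(1) by (force simp: M_def)
  \<comment> \<open>The complement of \<open>M + A\<close> is again a fragment, since \<open>A = -A\<close>.\<close>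
  have dual: "card M \<le> card (V - sumset M A)"
  proof -
    let ?T = "V - sumset M A"
    have disj: "sumset ?T A \<subseteq> V - M"
    proof
      fix z assume "z \<in> sumset ?T A"
      then obtain x a where z: "z = x \<oplus> a" "x \<in> V" "x \<notin> sumset M A" "a \<in> A"
        by (auto simp: sumset_def)
      have "z \<notin> M"
      proof
        assume "z \<in> M"
        then have "z \<oplus> a \<in> sumset M A" using z by (auto simp: sumset_def)
        moreover have "z \<oplus> a = x" using z A cancel bxor_commute by (metis subsetD)
        ultimately show False using z by simp
      qed
      then show "z \<in> V - M" using z A closed by auto
    qed
    have cT: "card ?T = card V - card (sumset M A)"
      using card_Diff_subset[OF fin subV] MV subV by simp
    have "card (sumset ?T A) \<le> card (V - M)" using disj finV by (intro card_mono) auto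
    also have "\<dots> = card V - card M" using card_Diff_subset[OF fin] MV by simp
    finally have le: "card (sumset ?T A) \<le> card V - card M" .
    have "?T \<noteq> {}" using MV subV[of M] by blast
    moreover have "sumset ?T A \<noteq> V" using disj MV by blast
    ultimately have "adm ?T" by (auto simp: adm_def)
    moreover have "card (sumset M A) \<le> card V" using subV[OF MV(1)] finV by (rule card_mono[rotated])
    \<comment> \<open>Since |T| = |V| - |M| - k, the bound \<open>le\<close> says |T + A| \<le> |T|
      + k, and \<open>lower\<close> gives the reverse.\<close>
    ultimately have "frag ?T"
      using lower[of ?T] le cT MV(4) by (auto simp: frag_def)
    then show ?thesis by (rule M(2))
  qed
  have sumM_le: "card (sumset M A) + card M \<le> card V"
    using dual card_Diff_subset[OF fin[OF subV[OF MV(1)]] subV[OF MV(1)]]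
      card_mono[OF finV subV[OF MV(1)]] by linarith
  \<comment> \<open>The translate by \<open>m\<close> contains \<open>m\<close> because 0 lies in
    \<open>M\<close>, so it meets \<open>M\<close>. Were the two different, their intersection would
    be too small to be a fragment and so would grow by more than \<open>k\<close>; submodularity
    then makes the union grow by less than \<open>k\<close>.\<close>
  have stab: "(\<oplus>) m ` M = M" if m: "m \<in> M" for m
  proof (rule ccontr)
    let ?Y = "(\<oplus>) m ` M"
    assume ne: "?Y \<noteq> M"
    have mV: "m \<in> V" using m MV by blast
    have Y: "frag ?Y" "card ?Y = card M" using transl[OF M(1) mV] by auto
    have YV: "?Y \<subseteq> V" "card (sumset ?Y A) = card M + k"
      using Y by (auto simp: frag_def adm_def)
    have "m \<in> ?Y" using M0in zero[OF mV] by force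
    then have I: "M \<inter> ?Y \<noteq> {}" using m by blast
    have "M \<inter> ?Y \<subset> M"
      using ne Y(2) card_subset_eq[OF fin[OF YV(1)]] by (metis inf.absorb_iff1 inf_le1 psubsetI)
    then have small: "card (M \<inter> ?Y) < card M" using fin MV by (simp add: psubset_card_mono)
    have "sumset (M \<inter> ?Y) A \<noteq> V"
      using sumset_Int[of M ?Y A] subV[OF MV(1)] MV(3) by blast
    then have admI: "adm (M \<inter> ?Y)" using I MV by (auto simp: adm_def)
    then have "\<not> frag (M \<inter> ?Y)" using M(2) small by fastforce
    then have big: "card (M \<inter> ?Y) + k < card (sumset (M \<inter> ?Y) A)"
      using lower[OF admI] admI by (auto simp: frag_def)
    have sub: "card (sumset (M \<union> ?Y) A) + card (sumset (M \<inter> ?Y) A) \<le> 2 * (card M + k)"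
      using card_sumset_submodular[of M A ?Y] fin subV MV YV by simp
    have un: "card (M \<union> ?Y) + card (M \<inter> ?Y) = 2 * card M"
      using card_Un_Int[OF fin[OF MV(1)] fin[OF YV(1)]] Y(2) by simp
    show False
    proof (cases "sumset (M \<union> ?Y) A = V")
      \<comment> \<open>Here the union is not admissible, but counting gives |V| < 2|M| + k = |M +
        A| + |M|, against \<open>sumM_le\<close>.\<close>
      case True
      then show False using sub big sumM_le MV(4) by simp
    next
      case False
      then have "adm (M \<union> ?Y)" using MV YV by (auto simp: adm_def)
      then show False using lower sub big un by fastforce
    qed
  qed
  have "bsubspace n M"
    unfolding bsubspace_def using MV(1) Vn M0in stab by blast
  \<comment> \<open>A subspace containing \<open>A\<close> would be all of \<open>V\<close>, whereas
    M + A, which contains \<open>M\<close>, is not.\<close>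
  then have "\<not> A \<subseteq> M" using gen[of M] MV(3) subV[OF MV(1)] sup[OF MV(1)] by auto
  then obtain a where a: "a \<in> A" "a \<notin> M" by blast
  have aV: "a \<in> V" using a A by blast
  have disj: "M \<inter> (\<oplus>) a ` M = {}"
  proof (rule ccontr)
    assume "M \<inter> (\<oplus>) a ` M \<noteq> {}"
    then obtain x where x: "x \<in> M" "a \<oplus> x \<in> M" by blast
    then have "x \<oplus> (a \<oplus> x) \<in> M" using stab by blast
    moreover have "x \<oplus> (a \<oplus> x) = a" using x aV MV cancel bxor_commute by (metis subsetD)
    ultimately show False using a by simp
  qed
  \<comment> \<open>M + A contains two disjoint cosets of \<open>M\<close>, so k \<ge> |M|. As it
    also contains \<open>A\<close>, |A| \<le> |M| + k \<le> 2k, and \<open>S\<close> grows by at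
    least k.\<close>
  have "M \<union> (\<oplus>) a ` M \<subseteq> sumset M A"
    using sup[OF MV(1)] a by (auto simp: sumset_def) (metis bxor_commute)
  then have "card (M \<union> (\<oplus>) a ` M) \<le> card (sumset M A)"
    using fin[OF subV[OF MV(1)]] by (rule card_mono[rotated])
  moreover have "card (M \<union> (\<oplus>) a ` M) = 2 * card M"
    using disj fin[OF MV(1)] card_translate[of a n M] aV Vn MV(1)
    by (simp add: card_Un_disjoint subset_iff)
  ultimately have "card M \<le> k" using MV(4) by simp
  moreover have "A \<subseteq> sumset M A"
  proof
    fix b assume "b \<in> A"
    then show "b \<in> sumset M A"
      using M0in zero[of b] A bxor_commute[of b] unfolding sumset_def by force
  qed
  then have "card A \<le> card M + k"
    using card_mono[OF fin[OF subV[OF MV(1)]]] MV(4) by simp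
  moreover have "card S + k \<le> card (sumset S A)" using S by (intro lower) (simp add: adm_def)
  ultimately show ?thesis by linarith
qed

text \<open>Both sumsets are nonempty and they are disjoint, so neither fills \<open>V\<close> and
  Olson's inequality applies to each; the two halves of |A| add up.\<close>

lemma card_disjoint_sumsets:
  assumes V: "bsubspace n V" and A: "A \<subseteq> V" "replicate n False \<in> A"
    and gen: "\<And>W. bsubspace n W \<Longrightarrow> A \<subseteq> W \<Longrightarrow> V \<subseteq> W"
    and S: "S \<subseteq> V" "S \<noteq> {}" and T: "T \<subseteq> V" "T \<noteq> {}"
    and disj: "sumset S A \<inter> sumset T A = {}"
  shows "card S + card T + card A \<le> card V"
proof -
  have sub: "sumset X A \<subseteq> V" if "X \<subseteq> V" for X
    using that A V by (auto simp: sumset_def bsubspace_def subset_iff)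
  have ne: "sumset X A \<noteq> {}" if "X \<noteq> {}" for X
    using that A by (auto simp: sumset_def)
  have finV: "finite V" using V finite_cube finite_subset unfolding bsubspace_def by blast
  have "sumset S A \<noteq> V" "sumset T A \<noteq> V"
    using disj sub[OF S(1)] sub[OF T(1)] ne[OF S(2)] ne[OF T(2)] by auto
  then have "2 * card S + card A \<le> 2 * card (sumset S A)"
    "2 * card T + card A \<le> 2 * card (sumset T A)"
    using olson_inequality[OF V A gen S] olson_inequality[OF V A gen T] by simp_all
  moreover have "card (sumset S A) + card (sumset T A) \<le> card V"
    using card_Un_disjoint[OF _ _ disj] card_mono[OF finV, of "sumset S A \<union> sumset T A"]
      sub[OF S(1)] sub[OF T(1)] finite_subset[OF _ finV] by simp
  ultimately show ?thesis by linarith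
qed

subsection \<open>Protocols and parity decision trees\<close>

text \<open>By Pascal's rule the maximum entry at most doubles from one row to the next, and row 1
  has maximum 1. This turns the binomial threshold into the power of two that the fibre size
  beats.\<close>

lemma Suc_choose_le_power: "Suc k choose j \<le> 2 ^ k"
proof (induction k arbitrary: j)
  case 0
  then show ?case by (cases j; cases "j - 1") auto
next
  case (Suc k)
  show ?case
  proof (cases j)
    case (Suc i)
    then show ?thesis using Suc.IH[of i] Suc.IH[of "Suc i"] by simp
  qed simp
qed

text \<open>Parities are linear: Alice sends those of \<open>x\<close>, and Bob adds those of
  \<open>y\<close> to obtain the tree's answers at x + y.\<close>

lemma Dcc_oneway_le_NADT_parity: "Dcc_oneway n (xor_fun f) \<le> NADT_parity n f"
proof -
  obtain ss l where tree: "na_parity_tree n f (NADT_parity n f) ss l"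
    using NADT_parity_attained by blast
  define h where "h x = map (\<lambda>s. ip2 s x) ss" for x
  have "h (x \<oplus> y) = h x \<oplus> h y" if "x \<in> cube n" "y \<in> cube n" for x y
    using that by (intro nth_equalityI) (auto simp: h_def bxor_def[of "map _ _"] ip2_bxor cube_def)
  then have "one_way_protocol n (xor_fun f) (NADT_parity n f) h (\<lambda>a y. l (a \<oplus> h y))"
    using tree unfolding one_way_protocol_def na_parity_tree_def xor_fun_def
    by (auto simp: bxor_in_cube h_def[symmetric]) (auto simp: h_def cube_def)
  then show ?thesis unfolding Dcc_oneway_def by (intro Least_le) blast
qed

text \<open>Averaging over the 2^t messages, written multiplicatively to avoid division.\<close>

lemma large_fibre:
  assumes h: "\<And>x. x \<in> cube n \<Longrightarrow> h x \<in> cube t"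
  shows "\<exists>c. 2 ^ n \<le> card {x \<in> cube n. h x = c} * 2 ^ t"
proof (rule ccontr)
  assume "\<not> ?thesis"
  then have *: "card {x \<in> cube n. h x = c} * 2 ^ t < 2 ^ n" for c by (simp add: not_le)
  have "2 ^ n = card (\<Union>c\<in>cube t. {x \<in> cube n. h x = c})"
    using h by (subst card_cube[symmetric]) (auto intro!: arg_cong[of _ _ card])
  also have "\<dots> = (\<Sum>c\<in>cube t. card {x \<in> cube n. h x = c})"
    by (rule card_UN_disjoint) auto
  finally have "2 ^ n * 2 ^ t = (\<Sum>c\<in>cube t. card {x \<in> cube n. h x = c} * 2 ^ t)"
    by (simp add: sum_distrib_right)
  also have "\<dots> < (\<Sum>c\<in>cube t. 2 ^ n)"
  proof (rule sum_strict_mono)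
    show "cube t \<noteq> {}" using card_cube[of t] by force
  qed (use * in auto)
  also have "\<dots> = 2 ^ n * 2 ^ t" by (simp add: card_cube)
  finally show False by simp
qed

lemma parity_tree_of_protocol:
  assumes prot: "one_way_protocol n (xor_fun f) t h \<phi>" and t: "t \<le> n"
    and few: "card {x \<in> cube n. f x = None} < 2 ^ (n - t)"
  shows "\<exists>ss l. na_parity_tree n f t ss l"
proof -
  have h: "h x \<in> cube t" if "x \<in> cube n" for x
    using prot that by (simp add: one_way_protocol_def)
  obtain c where c: "2 ^ n \<le> card {x \<in> cube n. h x = c} * 2 ^ t"
    using large_fibre[of n h t] h by blast
  define B where "B = {x \<in> cube n. h x = c}"
  have BV: "B \<subseteq> cube n" by (auto simp: B_def)
  have "B \<noteq> {}" using c unfolding B_def[symmetric] by auto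
  then obtain a where a: "a \<in> B" by blast
  then have an: "a \<in> cube n" by (simp add: B_def)
  define A where "A = (\<oplus>) a ` B"
  have cA: "2 ^ n \<le> card A * 2 ^ t"
    using c card_translate[OF an BV] by (simp add: A_def B_def)
  have "a \<oplus> a = replicate n False" using an by (simp add: bxor_self cube_def)
  then have A0: "replicate n False \<in> A" using a by (force simp: A_def)
  have An: "A \<subseteq> cube n" using BV an by (auto simp: A_def bxor_in_cube)
  \<comment> \<open>The span of \<open>A\<close>; the family intersected is nonempty because it
    contains \<open>cube n\<close>.\<close>
  define V where "V = \<Inter> {W. bsubspace n W \<and> A \<subseteq> W}"
  have V: "bsubspace n V"
    using bsubspace_cube An unfolding bsubspace_def V_def by blast
  have AV: "A \<subseteq> V" by (auto simp: V_def)
  have gen: "V \<subseteq> W" if "bsubspace n W" "A \<subseteq> W" for W using that by (auto simp: V_def)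
  have Vn: "V \<subseteq> cube n" using V by (simp add: bsubspace_def)
  have finV: "finite V" using Vn finite_cube finite_subset by blast
  have const: "f x = f y"
    if xy: "x \<in> cube n" "y \<in> cube n" "x \<oplus> y \<in> V" "f x \<noteq> None" "f y \<noteq> None" for x y
  proof (rule ccontr)
    assume ne: "f x \<noteq> f y"
    \<comment> \<open>The coset x + V is sorted by the value of \<open>f\<close>, each point being
      recorded by its displacement from \<open>x\<close>.\<close>
    define S where "S = {v \<in> V. f (x \<oplus> v) = f x}"
    define T where "T = {v \<in> V. f (x \<oplus> v) = f y}"
    define U where "U = {v \<in> V. f (x \<oplus> v) = None}"
    have "x \<oplus> replicate n False = x" using xy bxor_zero[of x] by (simp add: cube_def)
    then have "replicate n False \<in> S" using V by (simp add: S_def bsubspace_def)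
    moreover have "x \<oplus> y \<in> T" using xy by (simp add: T_def cube_cancel)
    moreover have "sumset S A \<inter> sumset T A = {}"
    proof (rule ccontr)
      assume "sumset S A \<inter> sumset T A \<noteq> {}"
      then obtain v w p q where vw: "v \<in> S" "w \<in> T" "p \<in> B" "q \<in> B"
        and eq: "v \<oplus> (a \<oplus> p) = w \<oplus> (a \<oplus> q)"
        unfolding sumset_def A_def by blast
      have cubes: "v \<in> cube n" "w \<in> cube n" "p \<in> cube n" "q \<in> cube n"
        using vw Vn by (auto simp: S_def T_def B_def)
      have "a \<oplus> (a \<oplus> (v \<oplus> p)) = a \<oplus> (a \<oplus> (w \<oplus> q))" using eq by (simp add: bxor_left_commute)
      then have eq': "v \<oplus> p = w \<oplus> q" using an cubes by (simp add: cube_cancel bxor_in_cube)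
      \<comment> \<open>As Bob's input, \<open>u\<close> gives p + u = x + v and q + u = x + w.
        Alice sends the same message \<open>c\<close> on \<open>p\<close> and \<open>q\<close>, so
        Bob's answer must equal both f x and f y.\<close>
      define u where "u = x \<oplus> (v \<oplus> p)"
      have u: "u \<in> cube n" using cubes xy by (simp add: u_def bxor_in_cube)
      have "p \<oplus> u = p \<oplus> (p \<oplus> (x \<oplus> v))" by (simp add: u_def bxor_ac)
      then have pu: "p \<oplus> u = x \<oplus> v" using cubes xy by (simp add: cube_cancel bxor_in_cube)
      have "q \<oplus> u = q \<oplus> (q \<oplus> (x \<oplus> w))" unfolding u_def eq' by (simp add: bxor_ac)
      then have qu: "q \<oplus> u = x \<oplus> w" using cubes xy by (simp add: cube_cancel bxor_in_cube)
      have val: "f (r \<oplus> u) = Some (\<phi> c u)" if "r \<in> B" "f (r \<oplus> u) \<noteq> None" for r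
        using prot that u by (auto simp: one_way_protocol_def xor_fun_def B_def)
      have "f x = Some (\<phi> c u)" using val[OF vw(3)] pu vw(1) xy(4) by (auto simp: S_def)
      moreover have "f y = Some (\<phi> c u)" using val[OF vw(4)] qu vw(2) xy(5) by (auto simp: T_def)
      ultimately show False using ne by simp
    qed
    moreover have "S \<subseteq> V" "T \<subseteq> V" by (auto simp: S_def T_def)
    ultimately have "card S + card T + card A \<le> card V"
      using card_disjoint_sumsets[OF V AV A0 gen, of S T] by blast
    moreover have "card V \<le> card S + card T + card U"
    proof -
      have "V \<subseteq> S \<union> T \<union> U"
      proof
        fix v assume "v \<in> V"
        then show "v \<in> S \<union> T \<union> U"
          using xy(4,5) ne by (cases "f (x \<oplus> v)") (auto simp: S_def T_def U_def)
      qed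
      moreover have "finite (S \<union> T \<union> U)" using finV by (auto simp: S_def T_def U_def)
      ultimately have "card V \<le> card (S \<union> T \<union> U)" by (intro card_mono)
      also have "\<dots> \<le> card S + card T + card U"
        using card_Un_le[of "S \<union> T" U] card_Un_le[of S T] by linarith
      finally show ?thesis .
    qed
    moreover have "card U \<le> card {x \<in> cube n. f x = None}"
    proof -
      have "card U = card ((\<oplus>) x ` U)"
        using Vn by (intro card_translate[OF xy(1), symmetric]) (auto simp: U_def)
      also have "\<dots> \<le> card {x \<in> cube n. f x = None}"
        using Vn xy(1) by (intro card_mono) (auto simp: U_def bxor_in_cube subset_iff)
      finally show ?thesis .
    qed
    \<comment> \<open>Comparing the two bounds around |V| cancels |S| + |T| and leaves |A| \<le>
      |U|.\<close>
    ultimately have "card A < 2 ^ (n - t)" using few by linarith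
    then have "card A * 2 ^ t < 2 ^ (n - t) * 2 ^ t" by simp
    also have "\<dots> = 2 ^ n" using t by (simp flip: power_add)
    finally show False using cA by simp
  qed
  have "card A \<le> card V" using AV finV by (rule card_mono[rotated])
  then have "2 ^ n \<le> card V * 2 ^ t" using cA by (meson le_trans mult_le_mono1)
  then obtain ss where ss: "length ss = t" "set ss \<subseteq> cube n"
    "\<And>x. x \<in> cube n \<Longrightarrow> \<forall>s\<in>set ss. \<not> ip2 s x \<Longrightarrow> x \<in> V"
    using parity_kernel_subset[OF V] by blast
  \<comment> \<open>A leaf answers True exactly when some input reaching it has value True;
    unreachable leaves get False.\<close>
  define l where "l z \<longleftrightarrow> (\<exists>x\<in>cube n. map (\<lambda>s. ip2 s x) ss = z \<and> f x = Some True)" for z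
  have "f x = Some (l (map (\<lambda>s. ip2 s x) ss))" if x: "x \<in> cube n" "f x \<noteq> None" for x
  proof -
    have same: "f y = f x"
      if y: "y \<in> cube n" "f y \<noteq> None" "map (\<lambda>s. ip2 s y) ss = map (\<lambda>s. ip2 s x) ss" for y
    proof -
      \<comment> \<open>Inputs reaching the same leaf differ by an element of the common kernel,
        hence of \<open>V\<close>, and \<open>const\<close> applies.\<close>
      have "\<forall>s\<in>set ss. \<not> ip2 s (y \<oplus> x)"
        using x y by (auto simp: ip2_bxor cube_def)
      then have "y \<oplus> x \<in> V" using ss(3) x y bxor_in_cube by blast
      then show ?thesis using const x y by blast
    qed
    obtain b where b: "f x = Some b" using x by blast
    have "l (map (\<lambda>s. ip2 s x) ss) = b"
      using same b x unfolding l_def by (cases b) force+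
    then show ?thesis using b by simp
  qed
  then have "na_parity_tree n f t ss l"
    using ss by (simp add: na_parity_tree_def)
  then show ?thesis by blast
qed

theorem theorem19:
  fixes n t :: nat and f :: "bool list \<Rightarrow> bool option"
  assumes "Dcc_oneway n (xor_fun f) = t"
    and "card {x \<in> cube n. f x = None} < binom (int n - int t + 1) ((int n - int t) div 2 - 1)"
  shows "NADT_parity n f = t"
proof (rule antisym)
  have t: "t \<le> n" using Dcc_oneway_le assms(1) by blast
  then have "nat (int n - int t + 1) = Suc (n - t)" by simp
  \<comment> \<open>Every entry of row n - t + 1 is at most 2^(n - t); for a negative lower index
    \<open>binom\<close> is 0.\<close>
  then have "binom (int n - int t + 1) ((int n - int t) div 2 - 1) \<le> 2 ^ (n - t)"
    using Suc_choose_le_power by (simp add: binom_def)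
  then have "card {x \<in> cube n. f x = None} < 2 ^ (n - t)" using assms(2) by linarith
  moreover obtain h \<phi> where "one_way_protocol n (xor_fun f) t h \<phi>"
    using Dcc_oneway_attained assms(1) by blast
  ultimately have "\<exists>ss l. na_parity_tree n f t ss l"
    using parity_tree_of_protocol t by blast
  then show "NADT_parity n f \<le> t" unfolding NADT_parity_def by (rule Least_le)
  show "t \<le> NADT_parity n f" using Dcc_oneway_le_NADT_parity assms(1) by blast
qed

end
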